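(* Let $n,m\ge1$ be integers, let $A,B$ be positive real numbers, and let $\mathbb{D}$ be the Chern connection on the Hermitian manifold $\mathbb{H}_{n,m}$ associated to the metric $$\begin{aligned}ds^2_{n,m;A,B}=\;&A\,\mathrm{Tr}(Y^{-1}dZ\,Y^{-1}d\overline Z)+B\left\{\mathrm{Tr}(Y^{-1}V^tVY^{-1}dZ\,Y^{-1}d\overline Z)+\mathrm{Tr}(Y^{-1}(dW)^td\overline W)\right\}\\&-B\left\{\mathrm{Tr}(VY^{-1}dZ\,Y^{-1}(d\overline W)^t)+\mathrm{Tr}(VY^{-1}d\overline Z\,Y^{-1}(dW)^t)\right\}.\end{aligned}$$ Then $$\mathbb{D}(dZ)=-\frac{\sqrt{-1}B}{2A}(dZ,dW^t)\begin{pmatrix}2\frac{A}{B}Y^{-1}+Y^{-1}V^tVY^{-1}&-Y^{-1}V^t\\-VY^{-1}&I\end{pmatrix}\begin{pmatrix}dZ\\ dW\end{pmatrix},$$ $$\mathbb{D}(dW)=-\frac{\sqrt{-1}B}{2A}VY^{-1}(dZ,dW^t)\begin{pmatrix}Y^{-1}V^tVY^{-1}&-Y^{-1}V^t\\-VY^{-1}&I\end{pmatrix}\begin{pmatrix}dZ\\ dW\end{pmatrix}-\sqrt{-1}\,dW\,Y^{-1}dZ.$$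
   Context: $\mathbb{H}_{n,m}=\mathbb{H}_n\times\mathbb{C}^{(m,n)}$, where $\mathbb{H}_n=\{Z\in M_{n,n}(\mathbb{C}):Z=Z^t,\ \mathrm{Im}(Z)>0\}$ and $\mathbb{C}^{(m,n)}$ is the space of complex $m\times n$ matrices; points are $(Z,W)$ with $Z=(z_{ij})$, $W=(w_{rs})$, and $Y=\mathrm{Im}(Z)$, $V=\mathrm{Im}(W)$. The holomorphic coordinates are $z_{ij}$ ($1\le i\le j\le n$) and $w_{rs}$ ($1\le r\le m$, $1\le s\le n$). $dZ=(dz_{ij})$ is the $n\times n$ matrix of differentials (with $dz_{ij}=dz_{ji}$) and $dW=(dw_{rs})$ the $m\times n$ matrix of differentials. The displayed metric is read as a Hermitian metric $\sum h_{\alpha\bar\beta}\,dz_\alpha d\bar z_\beta$ in these coordinates. The (holomorphic part of the) Chern connection has Christoffel coefficients $\Gamma^{\alpha}_{\gamma\beta}=\sum_i h^{\alpha\bar i}\frac{\partial h_{\beta\bar i}}{\partial z_\gamma}$, where $(h^{\alpha\bar i})$ denotes the inverse matrix of $(h_{\alpha\bar\beta})$ (so that $\sum_i h^{\alpha\bar i}h_{\beta\bar i}=\delta_{\alpha\beta}$), and $\mathbb{D}$ acts on the holomorphic coordinate differentials by $\mathbb{D}(dz_\alpha)=-\sum_{\beta,\gamma}\Gamma^\alpha_{\beta\gamma}\,dz_\beta dz_\gamma$. Products of differentials are symmetric products, and matrix products of matrices of differentials are formed using this product. $\mathbb{D}(dZ)$ is the matrix with entries $\mathbb{D}(dz_{ij})$,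 and $\mathbb{D}(dW)$ the matrix with entries $\mathbb{D}(dw_{rs})$. *)

theory Defs
  imports "HOL-Analysis.Analysis"
begin

section \<open>Hermitian metrics and the Chern connection in holomorphic coordinates\<close>

text \<open>
  Points and (1,0) tangent vectors are given by their components with respect to holomorphic
  coordinates indexed by a finite type. The differential of a coordinate is then a projection, a
  1-form of type (1,0) is a function of one tangent vector, and a symmetric 2-tensor is a function
  of two tangent vectors.
\<close>

type_synonym 'k one_form = "complex ^ 'k \<Rightarrow> complex"
type_synonym 'k two_tensor = "complex ^ 'k \<Rightarrow> complex ^ 'k \<Rightarrow> complex"

definition coord_diff :: "'k::finite \<Rightarrow> 'k one_form" where
  "coord_diff \<alpha> u = u $ \<alpha>"

definition sym_prod :: "'k::finite one_form \<Rightarrow> 'k one_form \<Rightarrow> 'k two_tensor" where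
  "sym_prod \<phi> \<psi> u v = (\<phi> u * \<psi> v + \<phi> v * \<psi> u) / 2"

text \<open>The Wirtinger derivative \<open>\<partial>/\<partial>z\<^sub>\<gamma> = (\<partial>/\<partial>x\<^sub>\<gamma> - \<i> \<partial>/\<partial>y\<^sub>\<gamma>) / 2\<close>.\<close>

definition wirtinger :: "(complex ^ 'k \<Rightarrow> complex) \<Rightarrow> 'k::finite \<Rightarrow> complex ^ 'k \<Rightarrow> complex" where
  "wirtinger f \<gamma> x =
     (frechet_derivative f (at x) (axis \<gamma> 1) - \<i> * frechet_derivative f (at x) (axis \<gamma> \<i>)) / 2"

text \<open>
  A metric is given by its coefficient matrices: \<open>h x $ \<alpha> $ \<beta>\<close> is the coefficient at \<open>x\<close> of
  \<open>dz\<^sub>\<alpha>\<close> times the conjugate of \<open>dz\<^sub>\<beta>\<close>. The transpose in the inverse comes from the convention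
  \<open>\<Sum>i. h\<^sup>\<alpha>\<^sup>i h\<^sub>\<beta>\<^sub>i = \<delta>\<^sub>\<alpha>\<^sub>\<beta>\<close>. In \<open>christoffel h x \<alpha> \<gamma> \<beta>\<close> the first lower index \<open>\<gamma>\<close> is the
  direction of differentiation.
\<close>

definition inverse_metric :: "(complex ^ 'k \<Rightarrow> complex ^ 'k ^ 'k) \<Rightarrow> complex ^ 'k \<Rightarrow> complex ^ 'k ^ 'k::finite"
  where "inverse_metric h x = matrix_inv (transpose (h x))"

definition christoffel ::
    "(complex ^ 'k \<Rightarrow> complex ^ 'k ^ 'k) \<Rightarrow> complex ^ 'k \<Rightarrow> 'k::finite \<Rightarrow> 'k \<Rightarrow> 'k \<Rightarrow> complex" where
  "christoffel h x \<alpha> \<gamma> \<beta> =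
     (\<Sum>i\<in>UNIV. inverse_metric h x $ \<alpha> $ i * wirtinger (\<lambda>y. h y $ \<beta> $ i) \<gamma> x)"

text \<open>\<open>chern_diff h x \<alpha>\<close> is \<open>D(dz\<^sub>\<alpha>)\<close> at the point \<open>x\<close>.\<close>

definition chern_diff ::
    "(complex ^ 'k \<Rightarrow> complex ^ 'k ^ 'k) \<Rightarrow> complex ^ 'k \<Rightarrow> 'k::finite \<Rightarrow> 'k two_tensor" where
  "chern_diff h x \<alpha> u v =
     - (\<Sum>\<beta>\<in>UNIV. \<Sum>\<gamma>\<in>UNIV. christoffel h x \<alpha> \<beta> \<gamma> * sym_prod (coord_diff \<beta>) (coord_diff \<gamma>) u v)"


section \<open>Matrices\<close>

definition hblock :: "'a ^ 'p ^ 'r \<Rightarrow> 'a ^ 'q ^ 'r \<Rightarrow> 'a ^ ('p::finite + 'q::finite) ^ 'r::finite" where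
  "hblock M N = (\<chi> i k. case k of Inl a \<Rightarrow> M $ i $ a | Inr b \<Rightarrow> N $ i $ b)"

definition vblock :: "'a ^ 'r ^ 'p \<Rightarrow> 'a ^ 'r ^ 'q \<Rightarrow> 'a ^ 'r::finite ^ ('p::finite + 'q::finite)" where
  "vblock M N = (\<chi> k. case k of Inl a \<Rightarrow> M $ a | Inr b \<Rightarrow> N $ b)"

definition mscale :: "'a::times \<Rightarrow> 'a ^ 'q ^ 'p \<Rightarrow> 'a ^ 'q::finite ^ 'p::finite" (infixr \<open>*\<^sub>m\<close> 75) where
  "c *\<^sub>m M = map_matrix (\<lambda>a. c * a) M"

text \<open>
  A matrix of 1-forms is treated as a matrix-valued function of a tangent vector, and similarly for
  2-tensors. The product of two matrices of 1-forms uses the symmetric product of their entries.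
\<close>

definition form_matrix_mult ::
    "(complex ^ 'k \<Rightarrow> complex ^ 'q ^ 'p) \<Rightarrow> (complex ^ 'k \<Rightarrow> complex ^ 'r ^ 'q) \<Rightarrow>
     complex ^ 'k::finite \<Rightarrow> complex ^ 'k \<Rightarrow> complex ^ 'r::finite ^ 'p::finite"
    (infixl \<open>\<odot>\<close> 70) where
  "(\<Phi> \<odot> \<Psi>) u v =
     (\<chi> i j. \<Sum>l\<in>UNIV. sym_prod (\<lambda>w. \<Phi> w $ i $ l) (\<lambda>w. \<Psi> w $ l $ j) u v)"

definition pos_def :: "real ^ 'n ^ 'n::finite \<Rightarrow> bool" where
  "pos_def Y \<longleftrightarrow> transpose Y = Y \<and> (\<forall>x. x \<noteq> 0 \<longrightarrow> x \<bullet> (Y *v x) > 0)"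

abbreviation Im_matrix :: "complex ^ 'q::finite ^ 'p::finite \<Rightarrow> real ^ 'q ^ 'p" where
  "Im_matrix \<equiv> map_matrix Im"

abbreviation complex_matrix :: "real ^ 'q::finite ^ 'p::finite \<Rightarrow> complex ^ 'q ^ 'p" where
  "complex_matrix \<equiv> map_matrix complex_of_real"


section \<open>The Siegel--Jacobi space and its metrics\<close>

definition siegel :: "(complex ^ 'n ^ 'n::finite) set" where
  "siegel = {Z. transpose Z = Z \<and> pos_def (Im_matrix Z)}"

definition siegel_jacobi :: "((complex ^ 'n ^ 'n::finite) \<times> (complex ^ 'n ^ 'm::finite)) set" where
  "siegel_jacobi = siegel \<times> UNIV"

text \<open>
  The coordinates are \<open>z\<^sub>i\<^sub>j\<close> for \<open>i \<le> j\<close> and \<open>w\<^sub>r\<^sub>s\<close>; \<open>z_index i j\<close> and \<open>z_index j i\<close> both name the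
  coordinate with \<open>i \<le> j\<close>, which encodes \<open>dz\<^sub>i\<^sub>j = dz\<^sub>j\<^sub>i\<close>.
\<close>

typedef (overloaded) 'n le_pair = "{(i, j). i \<le> (j :: 'n::linorder)}"
  by auto

instance le_pair :: ("{finite, linorder}") finite
proof
  have "finite ({(i, j). i \<le> j} :: ('a \<times> 'a) set)"
    by simp
  then show "finite (UNIV :: 'a le_pair set)"
    using type_definition.univ[OF type_definition_le_pair] by (metis finite_imageI)
qed

type_synonym ('n, 'm) coord = "'n le_pair + 'm \<times> 'n"

type_synonym ('n, 'm) coord_vec = "(complex, ('n, 'm) coord) vec"
type_synonym ('p, 'q) cmat = "((complex, 'q) vec, 'p) vec" (* p rows, q columns *)

definition z_index :: "'n \<Rightarrow> 'n \<Rightarrow> ('n::{finite, linorder}, 'm::finite) coord" where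
  "z_index i j = Inl (Abs_le_pair (min i j, max i j))"

definition w_index :: "'m \<Rightarrow> 'n \<Rightarrow> ('n::{finite, linorder}, 'm::finite) coord" where
  "w_index r s = Inr (r, s)"

definition coords ::
    "('n, 'n) cmat \<Rightarrow> ('m, 'n) cmat \<Rightarrow> ('n::{finite, linorder}, 'm::finite) coord_vec" where
  "coords Z W = (\<chi> \<alpha>. case \<alpha> of Inl p \<Rightarrow> Z $ fst (Rep_le_pair p) $ snd (Rep_le_pair p)
                             | Inr (r, s) \<Rightarrow> W $ r $ s)"

definition Z_of :: "('n::{finite, linorder}, 'm::finite) coord_vec \<Rightarrow> ('n, 'n) cmat" where
  "Z_of x = (\<chi> i j. x $ z_index i j)"

definition W_of :: "('n::{finite, linorder}, 'm::finite) coord_vec \<Rightarrow> ('m, 'n) cmat" where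
  "W_of x = (\<chi> r s. x $ w_index r s)"

definition dZ :: "('n::{finite, linorder}, 'm::finite) coord_vec \<Rightarrow> ('n, 'n) cmat" where
  "dZ u = (\<chi> i j. coord_diff (z_index i j) u)"

definition dW :: "('n::{finite, linorder}, 'm::finite) coord_vec \<Rightarrow> ('m, 'n) cmat" where
  "dW u = (\<chi> r s. coord_diff (w_index r s) u)"

text \<open>
  The metric as a sesquilinear form at the point \<open>(Z, W)\<close>: unbarred differentials are applied to the
  first tangent vector, barred differentials to the second one.
\<close>

definition ds2 ::
    "real \<Rightarrow> real \<Rightarrow> ('n, 'n) cmat \<Rightarrow> ('m, 'n) cmat \<Rightarrow>
     ('n::{finite, linorder}, 'm::finite) coord_vec \<Rightarrow> ('n, 'm) coord_vec \<Rightarrow> complex" where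
  "ds2 A B Z W u v =
    (let Yi = complex_matrix (matrix_inv (Im_matrix Z));
         V = complex_matrix (Im_matrix W);
         dZbar = map_matrix cnj (dZ v);
         dWbar = map_matrix cnj (dW v)
     in of_real A * trace (Yi ** dZ u ** Yi ** dZbar)
      + of_real B * (trace (Yi ** transpose V ** V ** Yi ** dZ u ** Yi ** dZbar)
                     + trace (Yi ** transpose (dW u) ** dWbar))
      - of_real B * (trace (V ** Yi ** dZ u ** Yi ** transpose dWbar)
                     + trace (V ** Yi ** dZbar ** Yi ** transpose (dW u))))"

definition sj_metric ::
    "real \<Rightarrow> real \<Rightarrow> ('n::{finite, linorder}, 'm::finite) coord_vec \<Rightarrow>
     ((complex, ('n, 'm) coord) vec, ('n, 'm) coord) vec" where
  "sj_metric A B x = (\<chi> \<alpha> \<beta>. ds2 A B (Z_of x) (W_of x) (axis \<alpha> 1) (axis \<beta> 1))"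

definition D_dZ ::
    "real \<Rightarrow> real \<Rightarrow> ('n, 'n) cmat \<Rightarrow> ('m, 'n) cmat \<Rightarrow>
     ('n::{finite, linorder}, 'm::finite) coord_vec \<Rightarrow> ('n, 'm) coord_vec \<Rightarrow> ('n, 'n) cmat"
  where
  "D_dZ A B Z W u v = (\<chi> i j. chern_diff (sj_metric A B) (coords Z W) (z_index i j) u v)"

definition D_dW ::
    "real \<Rightarrow> real \<Rightarrow> ('n, 'n) cmat \<Rightarrow> ('m, 'n) cmat \<Rightarrow>
     ('n::{finite, linorder}, 'm::finite) coord_vec \<Rightarrow> ('n, 'm) coord_vec \<Rightarrow> ('m, 'n) cmat"
  where
  "D_dW A B Z W u v = (\<chi> r s. chern_diff (sj_metric A B) (coords Z W) (w_index r s) u v)"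


section \<open>Consistency of the coordinate description\<close>

lemma Z_of_coords: "transpose Z = Z \<Longrightarrow> Z_of (coords Z W) = Z"
  by (auto simp: Z_of_def coords_def z_index_def vec_eq_iff transpose_def Abs_le_pair_inverse
      min_def max_def)

lemma W_of_coords: "W_of (coords Z W) = W"
  by (auto simp: W_of_def coords_def w_index_def vec_eq_iff)

lemma coords_Z_of_W_of: "coords (Z_of x) (W_of x) = x"
proof -
  have "Abs_le_pair (min (fst (Rep_le_pair p)) (snd (Rep_le_pair p)),
          max (fst (Rep_le_pair p)) (snd (Rep_le_pair p))) = p" for p :: "'a le_pair"
    using Rep_le_pair[of p] by (simp add: case_prod_beta min_def max_def Rep_le_pair_inverse)
  then show ?thesis
    by (auto simp: Z_of_def W_of_def coords_def z_index_def w_index_def vec_eq_iff split: sum.split)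
qed

lemma mscale_simps:
  fixes c :: complex
  shows "(c *\<^sub>m M) ** N = c *\<^sub>m (M ** N)"
    and "M' ** (c *\<^sub>m N') = c *\<^sub>m (M' ** N')"
    and "trace (c *\<^sub>m S) = c * trace S"
    and "transpose (c *\<^sub>m T) = c *\<^sub>m transpose T"
    and "map_matrix cnj (c *\<^sub>m T) = cnj c *\<^sub>m map_matrix cnj T"
  by (simp_all add: mscale_def matrix_matrix_mult_def trace_def transpose_def vec_eq_iff
      sum_distrib_left mult_ac)

lemma matrix_add_simps:
  fixes M :: "complex ^ 'q::finite ^ 'p::finite"
  shows "transpose (M + N) = transpose M + transpose N"
    and "map_matrix cnj (M + N) = map_matrix cnj M + map_matrix cnj N"
    and "(M + N) ** L = M ** L + N ** L"
    and "K ** (M + N) = K ** M + K ** N"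
  by (simp_all add: transpose_def matrix_matrix_mult_def vec_eq_iff sum.distrib
      distrib_left distrib_right)

lemma dZ_dW_linear:
  "dZ (u + u') = dZ u + dZ u'" "dZ (c *s u) = c *\<^sub>m dZ u"
  "dW (u + u') = dW u + dW u'" "dW (c *s u) = c *\<^sub>m dW u"
  by (simp_all add: dZ_def dW_def coord_diff_def mscale_def vec_eq_iff)

lemma ds2_linear_left:
  "ds2 A B Z W (u + u') v = ds2 A B Z W u v + ds2 A B Z W u' v"
  "ds2 A B Z W (c *s u) v = c * ds2 A B Z W u v"
  by (simp_all add: ds2_def Let_def dZ_dW_linear mscale_simps matrix_add_simps trace_add
      algebra_simps)

lemma ds2_antilinear_right:
  "ds2 A B Z W u (v + v') = ds2 A B Z W u v + ds2 A B Z W u v'"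
  "ds2 A B Z W u (c *s v) = cnj c * ds2 A B Z W u v"
  by (simp_all add: ds2_def Let_def dZ_dW_linear mscale_simps matrix_add_simps trace_add
      algebra_simps)

text \<open>The matrix \<open>sj_metric A B x\<close> consists of the coefficients of the metric in the coordinates.\<close>

lemma ds2_eq_sum:
  "ds2 A B (Z_of x) (W_of x) u v =
     (\<Sum>\<alpha>\<in>UNIV. \<Sum>\<beta>\<in>UNIV. sj_metric A B x $ \<alpha> $ \<beta> * coord_diff \<alpha> u * cnj (coord_diff \<beta> v))"
proof -
  let ?g = "ds2 A B (Z_of x) (W_of x)"
  have zero: "?g 0 w = 0" "?g w 0 = 0" for w
    using ds2_linear_left(2)[of A B "Z_of x" "W_of x" 0 0 w]
      ds2_antilinear_right(2)[of A B "Z_of x" "W_of x" w 0 0] by simp_all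
  have left: "?g (\<Sum>\<alpha>\<in>S. a \<alpha> *s e \<alpha>) w = (\<Sum>\<alpha>\<in>S. a \<alpha> * ?g (e \<alpha>) w)" if "finite S" for S a e w
    using that by (induction S rule: finite_induct) (simp_all add: zero ds2_linear_left)
  have right: "?g w (\<Sum>\<alpha>\<in>S. a \<alpha> *s e \<alpha>) = (\<Sum>\<alpha>\<in>S. cnj (a \<alpha>) * ?g w (e \<alpha>))" if "finite S" for S a e w
    using that by (induction S rule: finite_induct) (simp_all add: zero ds2_antilinear_right)
  have "?g u v = ?g (\<Sum>\<alpha>\<in>UNIV. u $ \<alpha> *s axis \<alpha> 1) (\<Sum>\<beta>\<in>UNIV. v $ \<beta> *s axis \<beta> 1)"
    by (simp add: basis_expansion)
  also have "\<dots> = (\<Sum>\<alpha>\<in>UNIV. u $ \<alpha> * (\<Sum>\<beta>\<in>UNIV. cnj (v $ \<beta>) * ?g (axis \<alpha> 1) (axis \<beta> 1)))"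
    by (subst left, simp, subst right, simp, rule refl)
  finally show ?thesis
    by (simp add: sj_metric_def coord_diff_def sum_distrib_left mult_ac)
qed

end

theory Submission
  imports Defs
begin

text \<open>
  Write \<open>X = Y\<^sup>-\<^sup>1\<close>, \<open>P = dZ(u)\<close>, \<open>Q = dW(u)\<close> for a tangent vector \<open>u\<close>, and put
  \<open>E(u) = Q - V X P\<close>. Since \<open>X\<close> and \<open>P\<close> are symmetric, completing the square gives
  \<open>ds\<^sup>2(u, v) = A Tr(X P X R) + B Tr(X E(u)\<^sup>t F)\<close>, where \<open>R\<close> and \<open>F\<close> are the complex conjugates of
  \<open>dZ(v)\<close> and \<open>E(v)\<close> (lemma \<open>ds2_completed_square\<close>).

  The coefficients depend on the point only through \<open>Y\<close> and \<open>V\<close>, hence the Wirtinger derivative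
  along \<open>u\<close> is \<open>1/(2\<i>)\<close> times the derivative in which \<open>Y\<close> and \<open>V\<close> move in the directions \<open>P\<close> and
  \<open>Q\<close>, extended complex linearly. In these directions \<open>X\<close> changes by \<open>- X P X\<close> and \<open>V X\<close> by \<open>E(u) X\<close>, so
  the derivative of the completed square is immediate (lemmas \<open>has_derivative_ds2\<close> and
  \<open>wirtinger_sj_metric\<close>).

  The Christoffel coefficients are characterised by \<open>ds\<^sup>2(\<Gamma>(u, w), v) = \<partial>\<^sub>u ds\<^sup>2(w, v)\<close> for all \<open>v\<close>,
  because \<open>ds\<^sup>2\<close> is nondegenerate (lemmas \<open>ds2_nondegenerate\<close> and \<open>christoffel_eqI\<close>). Comparing the
  terms with \<open>R\<close> and those with \<open>F\<close> gives, with \<open>P' = dZ(w)\<close>, \<open>E = E(u)\<close> and \<open>E' = E(w)\<close>,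
  \<open>dZ(\<Gamma>) = \<i>/2 (P X P' + P' X P + B/(2A) (E\<^sup>t E' + E'\<^sup>t E))\<close> and
  \<open>dW(\<Gamma>) - V X dZ(\<Gamma>) = \<i>/2 (E X P' + E' X P)\<close> (lemma \<open>ds2_gamma_vec\<close>). This is symmetric in \<open>u\<close> and
  \<open>w\<close>, so the connection is \<open>- \<Gamma>\<close> itself, and expanding \<open>E\<close> turns it into the stated block matrices.
\<close>

section \<open>Differentiating the inverse of a real matrix\<close>

lemma bounded_bilinear_matrix_mult:
  "bounded_bilinear
     ((**) :: 'a::{euclidean_space, real_algebra_1} ^ 'q::finite ^ 'p::finite \<Rightarrow>
              'a ^ 'r::finite ^ 'q \<Rightarrow> 'a ^ 'r ^ 'p)"
  unfolding bilinear_conv_bounded_bilinear[symmetric] bilinear_def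
  by (auto intro!: linearI simp: matrix_matrix_mult_def vec_eq_iff sum.distrib
       distrib_left distrib_right scaleR_sum_right)

lemmas has_derivative_matrix_mult =
  bounded_bilinear.FDERIV[OF bounded_bilinear_matrix_mult]

lemma matrix_mult_minus:
  fixes M :: "'a::ring_1 ^ 'q ^ 'p"
  shows "M ** - N = - (M ** N)" "- M ** N = - (M ** N)"
  by (simp_all add: matrix_matrix_mult_def vec_eq_iff sum_negf)

lemma matrix_mult_diff:
  fixes M :: "'a::ring_1 ^ 'q ^ 'p"
  shows "(M - N) ** L = M ** L - N ** L" "K ** (M - N) = K ** M - K ** N"
  by (simp_all add: matrix_matrix_mult_def vec_eq_iff sum_subtractf algebra_simps)

lemma matrix_inv_mult:
  fixes M :: "'a::field ^ 'n ^ 'n"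
  assumes "invertible M"
  shows "matrix_inv M ** M = mat 1" "M ** matrix_inv M = mat 1"
  using someI_ex[OF assms[unfolded invertible_def]] unfolding matrix_inv_def by auto

lemma differentiable_prod_real:
  fixes f :: "'i \<Rightarrow> 'a::real_normed_vector \<Rightarrow> real"
  assumes "finite S" "\<And>i. i \<in> S \<Longrightarrow> f i differentiable at x"
  shows "(\<lambda>y. \<Prod>i\<in>S. f i y) differentiable at x"
  using assms by (induction S rule: finite_induct) auto

lemma differentiable_det:
  fixes F :: "'a::real_normed_vector \<Rightarrow> real ^ 'n ^ 'n"
  assumes "\<And>i j. (\<lambda>y. F y $ i $ j) differentiable at x"
  shows "(\<lambda>y. det (F y)) differentiable at x"
  unfolding det_def
  by (intro differentiable_sum differentiable_mult differentiable_prod_real differentiable_const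
      ballI assms finite)

lemma eventually_invertible:
  fixes F :: "'a::real_normed_vector \<Rightarrow> real ^ 'n ^ 'n"
  assumes F: "\<And>i j. (\<lambda>y. F y $ i $ j) differentiable at x" and inv: "invertible (F x)"
  shows "\<forall>\<^sub>F y in nhds x. invertible (F y)"
proof -
  have "isCont (\<lambda>y. det (F y)) x"
    by (intro differentiable_imp_continuous_within differentiable_det F)
  then have "((\<lambda>y. det (F y)) \<longlongrightarrow> det (F x)) (nhds x)"
    unfolding isCont_def by (rule tendsto_at_iff_tendsto_nhds[THEN iffD1])
  moreover have "det (F x) \<noteq> 0"
    using inv by (simp add: invertible_det_nz)
  ultimately show ?thesis
    unfolding invertible_det_nz by (rule tendsto_imp_eventually_ne)
qed

text \<open>
  Cramer's rule for the columns of the inverse; its entries are thus rational in those of the matrix.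
\<close>

lemma matrix_inv_cramer:
  fixes M :: "'a::field ^ 'n ^ 'n"
  assumes "invertible M"
  shows "matrix_inv M $ k $ l = det (\<chi> i j. if j = k then mat 1 $ i $ l else M $ i $ j) / det M"
proof -
  have "M *v (\<chi> i. matrix_inv M $ i $ l) = (\<chi> i. mat 1 $ i $ l)"
    using matrix_inv_mult(2)[OF assms]
    by (simp add: vec_eq_iff matrix_vector_mult_def matrix_matrix_mult_def)
  then have "(\<chi> i. matrix_inv M $ i $ l)
      = (\<chi> k. det (\<chi> i j. if j = k then (\<chi> i. mat 1 $ i $ l) $ i else M $ i $ j) / det M)"
    using cramer assms[unfolded invertible_det_nz] by fastforce
  then show ?thesis
    by (simp add: vec_eq_iff cong: if_cong)
qed

text \<open>
  By Cramer's rule the inverse is differentiable; its derivative then follows from the product rule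
  applied to \<open>F y ** matrix_inv (F y) = mat 1\<close>, an equation that holds near \<open>x\<close>.
\<close>

lemma has_derivative_matrix_inv:
  fixes F :: "'a::euclidean_space \<Rightarrow> real ^ 'n ^ 'n"
  assumes F: "(F has_derivative F') (at x)" and inv: "invertible (F x)"
  shows "((\<lambda>y. matrix_inv (F y)) has_derivative
           (\<lambda>t. - (matrix_inv (F x) ** F' t ** matrix_inv (F x)))) (at x)"
proof -
  have entry: "(\<lambda>y. F y $ i $ j) differentiable at x" for i j
    using F by (auto intro!: differentiableI bounded_linear.has_derivative[OF bounded_linear_vec_nth])
  obtain S where S: "open S" "x \<in> S" "\<And>y. y \<in> S \<Longrightarrow> invertible (F y)"
    using eventually_invertible[OF entry inv] by (auto simp: eventually_nhds)
  have inv_entry: "(\<lambda>y. matrix_inv (F y) $ k $ l) differentiable at x" for k l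
  proof -
    have "(\<lambda>y. (\<chi> i j. if j = k then mat 1 $ i $ l else F y $ i $ j) $ i $ j) differentiable at x" for i j
      by (cases "j = k") (simp_all add: entry)
    then have num: "(\<lambda>y. det (\<chi> i j. if j = k then mat 1 $ i $ l else F y $ i $ j)) differentiable at x"
      by (rule differentiable_det)
    have "(\<lambda>y. det (\<chi> i j. if j = k then mat 1 $ i $ l else F y $ i $ j) / det (F y)) differentiable at x"
      by (rule differentiable_divide[OF num differentiable_det[OF entry]])
        (use inv in \<open>simp add: invertible_det_nz\<close>)
    then obtain D where D: "((\<lambda>y. det (\<chi> i j. if j = k then mat 1 $ i $ l else F y $ i $ j) / det (F y))
        has_derivative D) (at x)"
      unfolding differentiable_def by blast
    have "((\<lambda>y. matrix_inv (F y) $ k $ l) has_derivative D) (at x)"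
      by (rule has_derivative_transform_within_open[OF D S(1,2)]) (simp add: matrix_inv_cramer S(3))
    then show ?thesis
      by (rule differentiableI)
  qed
  have "(\<lambda>y. matrix_inv (F y)) differentiable at x"
    by (rule differentiable_componentwise_within[THEN iffD2])
      (auto simp: Basis_vec_def inner_axis intro!: inv_entry)
  then obtain X' where X': "((\<lambda>y. matrix_inv (F y)) has_derivative X') (at x)"
    unfolding differentiable_def by blast
  have "((\<lambda>y. F y ** matrix_inv (F y)) has_derivative (\<lambda>t. F x ** X' t + F' t ** matrix_inv (F x))) (at x)"
    by (rule has_derivative_matrix_mult[OF F X'])
  moreover have "((\<lambda>y. F y ** matrix_inv (F y)) has_derivative (\<lambda>t. 0)) (at x)"
    by (rule has_derivative_transform_within_open[OF has_derivative_const S(1,2)])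
      (simp add: matrix_inv_mult S(3))
  ultimately have eq: "(\<lambda>t. F x ** X' t + F' t ** matrix_inv (F x)) = (\<lambda>t. 0)"
    by (rule has_derivative_unique)
  have "X' = (\<lambda>t. - (matrix_inv (F x) ** F' t ** matrix_inv (F x)))"
  proof
    fix t
    have "F x ** X' t = - (F' t ** matrix_inv (F x))"
      using fun_cong[OF eq, of t] by (simp add: eq_neg_iff_add_eq_0)
    then have "matrix_inv (F x) ** (F x ** X' t) = - (matrix_inv (F x) ** (F' t ** matrix_inv (F x)))"
      by (simp add: matrix_mult_minus)
    then show "X' t = - (matrix_inv (F x) ** F' t ** matrix_inv (F x))"
      by (simp add: matrix_mul_assoc matrix_inv_mult inv)
  qed
  then show ?thesis
    using X' by simp
qed

section \<open>Matrix algebra and linear operations on matrices\<close>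

lemma complex_matrix_simps:
  "complex_matrix (M ** N) = complex_matrix M ** complex_matrix N"
  "complex_matrix (transpose M) = transpose (complex_matrix M)"
  "complex_matrix (mat 1) = mat 1"
  "complex_matrix (- M) = - complex_matrix M"
  by (simp_all add: matrix_matrix_mult_def transpose_def mat_def vec_eq_iff)

lemma transpose_diff: "transpose (M - N :: 'a::ab_group_add ^ 'q ^ 'p) = transpose M - transpose N"
  by (simp add: transpose_def vec_eq_iff)

lemma transpose_minus: "transpose (- M :: 'a::ab_group_add ^ 'q ^ 'p) = - transpose M"
  by (simp add: transpose_def vec_eq_iff)

lemma trace_minus: "trace (- M :: 'a::comm_ring_1 ^ 'p ^ 'p) = - trace M"
  by (simp add: trace_def sum_negf)

lemma trace_transpose: "trace (transpose M) = trace M"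
  by (simp add: trace_def transpose_def)

lemma transpose_matrix_inv:
  fixes M :: "'a::field ^ 'n ^ 'n"
  assumes "invertible M" "transpose M = M"
  shows "transpose (matrix_inv M) = matrix_inv M"
proof -
  have "transpose (matrix_inv M) ** M = mat 1"
    using arg_cong[OF matrix_inv_mult(2)[OF assms(1)], of transpose] assms(2)
    by (simp add: matrix_transpose_mul)
  then have "transpose (matrix_inv M) ** M ** matrix_inv M = matrix_inv M"
    by simp
  then show ?thesis
    by (simp add: matrix_inv_mult(2)[OF assms(1)] flip: matrix_mul_assoc)
qed

lemma bounded_linear_complex_matrix:
  "bounded_linear (complex_matrix :: real ^ 'q::finite ^ 'p::finite \<Rightarrow> _)"
  unfolding linear_conv_bounded_linear[symmetric]
  by (auto intro!: linearI simp: vec_eq_iff scaleR_conv_of_real[where 'a = complex])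

lemma bounded_linear_transpose:
  "bounded_linear (transpose :: 'a::euclidean_space ^ 'q::finite ^ 'p::finite \<Rightarrow> _)"
  unfolding linear_conv_bounded_linear[symmetric]
  by (auto intro!: linearI simp: vec_eq_iff transpose_def)

lemma bounded_linear_trace:
  "bounded_linear (trace :: complex ^ 'p::finite ^ 'p \<Rightarrow> _)"
  unfolding linear_conv_bounded_linear[symmetric]
  by (auto intro!: linearI simp: trace_def sum.distrib scaleR_sum_right)

section \<open>The completed square\<close>

lemma bounded_linear_Im_Z:
  "bounded_linear (\<lambda>y :: ('n::{finite, linorder}, 'm::finite) coord_vec. Im_matrix (Z_of y))"
  unfolding linear_conv_bounded_linear[symmetric]
  by (auto intro!: linearI simp: vec_eq_iff Z_of_def)

lemma bounded_linear_Im_W: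
  "bounded_linear (\<lambda>y :: ('n::{finite, linorder}, 'm::finite) coord_vec. Im_matrix (W_of y))"
  unfolding linear_conv_bounded_linear[symmetric]
  by (auto intro!: linearI simp: vec_eq_iff W_of_def)

lemma dZ_eq_Z_of: "dZ = Z_of"
  by (simp add: fun_eq_iff dZ_def Z_of_def coord_diff_def)

lemma dW_eq_W_of: "dW = W_of"
  by (simp add: fun_eq_iff dW_def W_of_def coord_diff_def)

lemma transpose_Z_of: "transpose (Z_of x) = Z_of x"
  by (simp add: vec_eq_iff transpose_def Z_of_def z_index_def min.commute max.commute)

text \<open>The matrix \<open>Y\<^sup>-\<^sup>1\<close> as a function of the coordinates of the point \<open>(Z, W)\<close>.\<close>

definition Yi_at :: "('n::{finite, linorder}, 'm::finite) coord_vec \<Rightarrow> ('n, 'n) cmat" where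
  "Yi_at x = complex_matrix (matrix_inv (Im_matrix (Z_of x)))"

text \<open>The matrix \<open>V Y\<^sup>-\<^sup>1\<close> as a function of the coordinates of the point \<open>(Z, W)\<close>.\<close>

definition VYi_at :: "('n::{finite, linorder}, 'm::finite) coord_vec \<Rightarrow> ('m, 'n) cmat" where
  "VYi_at x = complex_matrix (Im_matrix (W_of x)) ** Yi_at x"

text \<open>
  The matrix of (1,0)-forms \<open>dW - V Y\<^sup>-\<^sup>1 dZ\<close> at the point with coordinates \<open>x\<close>: together with \<open>dZ\<close> it
  makes the metric block diagonal.
\<close>

definition adapted_dW ::
    "('n::{finite, linorder}, 'm::finite) coord_vec \<Rightarrow> ('n, 'm) coord_vec \<Rightarrow> ('m, 'n) cmat" where
  "adapted_dW x u = dW u - VYi_at x ** dZ u"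

lemma transpose_dZ: "transpose (dZ u) = dZ u"
  by (simp add: dZ_eq_Z_of transpose_Z_of)

lemma transpose_Im_Z_of: "transpose (Im_matrix (Z_of x)) = Im_matrix (Z_of x)"
  using transpose_Z_of[of x] by (simp add: vec_eq_iff transpose_def)

lemma transpose_Yi_at:
  assumes "invertible (Im_matrix (Z_of x))"
  shows "transpose (Yi_at x) = Yi_at x"
  using transpose_matrix_inv[OF assms transpose_Im_Z_of]
  by (simp add: Yi_at_def flip: complex_matrix_simps)

lemma map_cnj_mult: "map_matrix cnj (M ** N) = map_matrix cnj M ** map_matrix cnj N"
  by (simp add: matrix_matrix_mult_def vec_eq_iff)

lemma map_cnj_diff: "map_matrix cnj (M - N) = map_matrix cnj M - map_matrix cnj N"
  by (simp add: vec_eq_iff)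

lemma map_cnj_transpose: "map_matrix cnj (transpose M) = transpose (map_matrix cnj M)"
  by (simp add: vec_eq_iff transpose_def)

lemma map_cnj_complex_matrix: "map_matrix cnj (complex_matrix M) = complex_matrix M"
  by (simp add: vec_eq_iff)

lemma cnj_adapted_dW:
  "map_matrix cnj (adapted_dW x v) = map_matrix cnj (dW v) - VYi_at x ** map_matrix cnj (dZ v)"
  by (simp add: adapted_dW_def VYi_at_def Yi_at_def map_cnj_mult map_cnj_diff map_cnj_complex_matrix)

lemma ds2_completed_square:
  assumes "invertible (Im_matrix (Z_of x))"
  shows "ds2 A B (Z_of x) (W_of x) u v =
     of_real A * trace (Yi_at x ** dZ u ** Yi_at x ** map_matrix cnj (dZ v))
     + of_real B * trace (Yi_at x ** transpose (adapted_dW x u) ** map_matrix cnj (adapted_dW x v))"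
proof -
  define X where "X = Yi_at x"
  define V where "V = complex_matrix (Im_matrix (W_of x))"
  define P where "P = dZ u"
  define Q where "Q = dW u"
  define R where "R = map_matrix cnj (dZ v)"
  define S where "S = map_matrix cnj (dW v)"
  have X: "transpose X = X"
    unfolding X_def by (rule transpose_Yi_at[OF assms])
  have P: "transpose P = P" and R: "transpose R = R"
    by (simp_all add: P_def R_def transpose_dZ flip: map_cnj_transpose)
  note assoc = matrix_mul_assoc matrix_transpose_mul
  \<comment> \<open>Each identity rotates the trace cyclically, \<open>1\<close> and \<open>3\<close> after transposing its argument.\<close>
  have 1: "trace (X ** P ** X ** transpose V ** V ** X ** R)
      = trace (X ** transpose V ** V ** X ** P ** X ** R)"
    using trace_transpose[of "X ** P ** X ** transpose V ** V ** X ** R"]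
      trace_mul_sym[of R "X ** transpose V ** V ** X ** P ** X"]
    by (simp add: assoc X P R)
  have 2: "trace (X ** transpose Q ** V ** X ** R) = trace (V ** X ** R ** X ** transpose Q)"
    using trace_mul_sym[of "X ** transpose Q" "V ** X ** R"] by (simp add: assoc)
  have 3: "trace (X ** P ** X ** transpose V ** S) = trace (V ** X ** P ** X ** transpose S)"
    using trace_transpose[of "X ** P ** X ** transpose V ** S"]
      trace_mul_sym[of "transpose S" "V ** X ** P ** X"]
    by (simp add: assoc X P)
  have "ds2 A B (Z_of x) (W_of x) u v = of_real A * trace (X ** P ** X ** R)
      + of_real B * (trace (X ** transpose V ** V ** X ** P ** X ** R) + trace (X ** transpose Q ** S))
      - of_real B * (trace (V ** X ** P ** X ** transpose S) + trace (V ** X ** R ** X ** transpose Q))"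
    by (simp add: ds2_def Let_def X_def V_def P_def Q_def R_def S_def Yi_at_def)
  also have "\<dots> = of_real A * trace (X ** P ** X ** R)
     + of_real B * trace (X ** transpose (Q - V ** X ** P) ** (S - V ** X ** R))"
    by (simp add: transpose_diff matrix_mult_diff trace_sub assoc X P 1 2 3 right_diff_distrib distrib_left)
  finally show ?thesis
    by (simp only: cnj_adapted_dW) (simp add: adapted_dW_def VYi_at_def X_def V_def P_def Q_def R_def S_def)
qed

section \<open>The derivative of the metric\<close>

text \<open>
  \<open>Im_dZ t\<close> and \<open>Im_dW t\<close> are the directions in which \<open>Y\<close> and \<open>V\<close> move when the point moves along
  the real tangent vector \<open>t\<close>.
\<close>

abbreviation Im_dZ :: "('n::{finite, linorder}, 'm::finite) coord_vec \<Rightarrow> ('n, 'n) cmat" where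
  "Im_dZ t \<equiv> complex_matrix (Im_matrix (dZ t))"

abbreviation Im_dW :: "('n::{finite, linorder}, 'm::finite) coord_vec \<Rightarrow> ('m, 'n) cmat" where
  "Im_dW t \<equiv> complex_matrix (Im_matrix (dW t))"

lemma has_derivative_Yi_at:
  assumes "invertible (Im_matrix (Z_of x))"
  shows "(Yi_at has_derivative (\<lambda>t. - (Yi_at x ** Im_dZ t ** Yi_at x))) (at x)"
  using bounded_linear.has_derivative[OF bounded_linear_complex_matrix
      has_derivative_matrix_inv[OF bounded_linear_imp_has_derivative[OF bounded_linear_Im_Z] assms]]
  unfolding Yi_at_def[abs_def] by (simp add: complex_matrix_simps dZ_eq_Z_of)

lemma has_derivative_VYi_at:
  assumes "invertible (Im_matrix (Z_of x))"
  shows "(VYi_at has_derivative (\<lambda>t. (Im_dW t - VYi_at x ** Im_dZ t) ** Yi_at x)) (at x)"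
proof -
  have V: "((\<lambda>y. complex_matrix (Im_matrix (W_of y))) has_derivative Im_dW) (at x)"
    unfolding dW_eq_W_of
    by (rule bounded_linear.has_derivative[OF bounded_linear_complex_matrix
          bounded_linear_imp_has_derivative[OF bounded_linear_Im_W]])
  show ?thesis
    using has_derivative_matrix_mult[OF V has_derivative_Yi_at[OF assms]]
    unfolding VYi_at_def[abs_def]
    by (simp add: matrix_mult_diff matrix_mult_minus matrix_mul_assoc)
qed

lemma has_derivative_adapted_dW:
  assumes "invertible (Im_matrix (Z_of x))"
  shows "((\<lambda>y. adapted_dW y u) has_derivative
    (\<lambda>t. - ((Im_dW t - VYi_at x ** Im_dZ t) ** Yi_at x ** dZ u))) (at x)"
  using has_derivative_diff[OF has_derivative_const
      has_derivative_matrix_mult[OF has_derivative_VYi_at[OF assms] has_derivative_const]]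
  unfolding adapted_dW_def[abs_def] by simp

lemma has_derivative_cnj_adapted_dW:
  assumes "invertible (Im_matrix (Z_of x))"
  shows "((\<lambda>y. map_matrix cnj (adapted_dW y u)) has_derivative
    (\<lambda>t. - ((Im_dW t - VYi_at x ** Im_dZ t) ** Yi_at x ** map_matrix cnj (dZ u)))) (at x)"
  using has_derivative_diff[OF has_derivative_const
      has_derivative_matrix_mult[OF has_derivative_VYi_at[OF assms] has_derivative_const]]
  unfolding cnj_adapted_dW[abs_def] by simp

text \<open>
  The derivative of \<open>ds\<^sup>2(u, v)\<close> at the point \<open>x\<close> when \<open>Y\<close> and \<open>V\<close> move in the directions \<open>a\<close> and \<open>b\<close>.
  These directions are taken complex, so that \<open>dZ\<close> and \<open>dW\<close> of a (1,0)-vector may be substituted.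
\<close>

definition metric_deriv ::
    "real \<Rightarrow> real \<Rightarrow> ('n, 'm) coord_vec \<Rightarrow> ('n, 'n) cmat \<Rightarrow> ('m, 'n) cmat \<Rightarrow>
     ('n::{finite, linorder}, 'm::finite) coord_vec \<Rightarrow> ('n, 'm) coord_vec \<Rightarrow> complex" where
  "metric_deriv A B x a b u v =
    (let X = Yi_at x; e = b - VYi_at x ** a; R = map_matrix cnj (dZ v) in
      - (of_real A * (trace (X ** a ** X ** dZ u ** X ** R) + trace (X ** dZ u ** X ** a ** X ** R))
        + of_real B * (trace (X ** a ** X ** transpose (adapted_dW x u) ** map_matrix cnj (adapted_dW x v))
                     + trace (X ** transpose (e ** X ** dZ u) ** map_matrix cnj (adapted_dW x v))
                     + trace (X ** transpose (adapted_dW x u) ** e ** X ** R))))"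

lemma eventually_invertible_Im_Z:
  assumes "invertible (Im_matrix (Z_of x))"
  shows "\<forall>\<^sub>F y in nhds x. invertible (Im_matrix (Z_of y))"
proof (rule eventually_invertible[where F = "\<lambda>y. Im_matrix (Z_of y)", OF _ assms])
  show "(\<lambda>y. Im_matrix (Z_of y) $ i $ j) differentiable at x" for i j
    by (rule differentiableI, rule bounded_linear.has_derivative[OF bounded_linear_vec_nth],
        rule bounded_linear.has_derivative[OF bounded_linear_vec_nth],
        rule bounded_linear_imp_has_derivative[OF bounded_linear_Im_Z])
qed

lemma has_derivative_ds2:
  assumes inv: "invertible (Im_matrix (Z_of x))"
  shows "((\<lambda>y. ds2 A B (Z_of y) (W_of y) u v) has_derivative
          (\<lambda>t. metric_deriv A B x (Im_dZ t) (Im_dW t) u v)) (at x)"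
proof -
  obtain S where S: "open S" "x \<in> S" "\<And>y. y \<in> S \<Longrightarrow> invertible (Im_matrix (Z_of y))"
    using eventually_invertible_Im_Z[OF inv] by (auto simp: eventually_nhds)
  let ?R = "map_matrix cnj (dZ v)"
  note X = has_derivative_Yi_at[OF inv]
  note E = bounded_linear.has_derivative[OF bounded_linear_transpose has_derivative_adapted_dW[OF inv, of u]]
  note F = has_derivative_cnj_adapted_dW[OF inv, of v]
  note tr = bounded_linear.has_derivative[OF bounded_linear_trace]
  note mult = has_derivative_matrix_mult
  note const = has_derivative_const
  have 1: "((\<lambda>y. trace (Yi_at y ** dZ u ** Yi_at y ** ?R)) has_derivative
     (\<lambda>t. - (trace (Yi_at x ** Im_dZ t ** Yi_at x ** dZ u ** Yi_at x ** ?R)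
          + trace (Yi_at x ** dZ u ** Yi_at x ** Im_dZ t ** Yi_at x ** ?R)))) (at x)"
    by (rule has_derivative_eq_rhs[OF tr[OF mult[OF mult[OF mult[OF X const] X] const]]])
      (simp add: fun_eq_iff trace_add trace_sub trace_minus matrix_add_simps matrix_mult_minus matrix_mult_diff
        matrix_mul_assoc)
  have 2: "((\<lambda>y. trace (Yi_at y ** transpose (adapted_dW y u) ** map_matrix cnj (adapted_dW y v))) has_derivative
     (\<lambda>t. let e = Im_dW t - VYi_at x ** Im_dZ t in
        - (trace (Yi_at x ** Im_dZ t ** Yi_at x ** transpose (adapted_dW x u) ** map_matrix cnj (adapted_dW x v))
         + trace (Yi_at x ** transpose (e ** Yi_at x ** dZ u) ** map_matrix cnj (adapted_dW x v))
         + trace (Yi_at x ** transpose (adapted_dW x u) ** e ** Yi_at x ** ?R)))) (at x)"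
    by (rule has_derivative_eq_rhs[OF tr[OF mult[OF mult[OF X E] F]]])
      (simp add: fun_eq_iff trace_add trace_sub trace_minus transpose_minus transpose_diff
        matrix_add_simps matrix_mult_minus matrix_mult_diff matrix_mul_assoc Let_def)
  have "((\<lambda>y. of_real A * trace (Yi_at y ** dZ u ** Yi_at y ** ?R)
        + of_real B * trace (Yi_at y ** transpose (adapted_dW y u) ** map_matrix cnj (adapted_dW y v))) has_derivative
          (\<lambda>t. metric_deriv A B x (Im_dZ t) (Im_dW t) u v)) (at x)"
    by (rule has_derivative_eq_rhs[OF has_derivative_add[OF
          bounded_linear.has_derivative[OF bounded_linear_mult_right 1]
          bounded_linear.has_derivative[OF bounded_linear_mult_right 2]]])
      (simp add: fun_eq_iff metric_deriv_def Let_def algebra_simps)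
  then show ?thesis
    by (rule has_derivative_transform_within_open[OF _ S(1,2)]) (simp add: ds2_completed_square S(3))
qed

text \<open>
  A real coordinate direction moves neither \<open>Y\<close> nor \<open>V\<close>, and an imaginary one moves them by \<open>dZ\<close> and
  \<open>dW\<close> of the basis vector.
\<close>

lemma wirtinger_sj_metric:
  assumes inv: "invertible (Im_matrix (Z_of x))"
  shows "wirtinger (\<lambda>y. sj_metric A B y $ \<beta> $ \<delta>) \<gamma> x =
     - (\<i> / 2) * metric_deriv A B x (dZ (axis \<gamma> 1)) (dW (axis \<gamma> 1)) (axis \<beta> 1) (axis \<delta> 1)"
proof -
  have re: "Im_dZ (axis \<gamma> 1) = 0" "Im_dW (axis \<gamma> 1) = 0"
    and im: "Im_dZ (axis \<gamma> \<i>) = dZ (axis \<gamma> 1)" "Im_dW (axis \<gamma> \<i>) = dW (axis \<gamma> 1)"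
    by (simp_all add: vec_eq_iff dZ_def dW_def coord_diff_def axis_def)
  have "frechet_derivative (\<lambda>y. sj_metric A B y $ \<beta> $ \<delta>) (at x) =
      (\<lambda>t. metric_deriv A B x (Im_dZ t) (Im_dW t) (axis \<beta> 1) (axis \<delta> 1))"
    using frechet_derivative_at[OF has_derivative_ds2[OF inv]]
    by (simp add: sj_metric_def)
  moreover have "metric_deriv A B x 0 0 u v = 0" for u v
    by (simp add: metric_deriv_def Let_def trace_def matrix_matrix_mult_def transpose_def)
  ultimately show ?thesis
    by (simp add: wirtinger_def re im)
qed

section \<open>Nondegeneracy and the characterisation of the Christoffel coefficients\<close>

lemma trace_transpose_cnj:
  "trace (transpose M ** map_matrix cnj M) = of_real (\<Sum>j\<in>UNIV. \<Sum>i\<in>UNIV. (cmod (M $ i $ j))\<^sup>2)"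
  by (simp add: trace_def transpose_def matrix_matrix_mult_def flip: complex_norm_square)

lemma dZ_coords: "transpose Z = Z \<Longrightarrow> dZ (coords Z W) = Z"
  by (simp add: dZ_eq_Z_of Z_of_coords)

lemma dW_coords: "dW (coords Z W) = W"
  by (simp add: dW_eq_W_of W_of_coords)

text \<open>The metric is nondegenerate wherever \<open>Y\<close> is invertible.\<close>

lemma ds2_nondegenerate:
  assumes "A > 0" "B > 0" and inv: "invertible (Im_matrix (Z_of x))"
    and zero: "\<And>v. ds2 A B (Z_of x) (W_of x) u v = 0"
  shows "u = 0"
proof -
  define X where "X = Yi_at x"
  define Y where "Y = complex_matrix (Im_matrix (Z_of x))"
  define P where "P = dZ u"
  define E where "E = adapted_dW x u"
  have XY: "X ** Y = mat 1" and YX: "Y ** X = mat 1"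
    using matrix_inv_mult[OF inv]
    by (simp_all add: X_def Y_def Yi_at_def complex_matrix_simps flip: complex_matrix_simps(1))
  have Y: "transpose Y = Y" and P: "transpose P = P"
    by (simp_all add: Y_def P_def transpose_Im_Z_of transpose_dZ flip: complex_matrix_simps)
  have cnj_Y: "map_matrix cnj Y = Y"
    by (simp add: Y_def map_cnj_complex_matrix)
  \<comment> \<open>The test vector with \<open>dZ(v) = Y P Y\<close> and \<open>E(v) = E(u) Y\<close> cancels the factors \<open>Y\<^sup>-\<^sup>1\<close> in the completed
     square and leaves the squared norms of \<open>P\<close> and \<open>E(u)\<close>.\<close>
  define v where "v = coords (Y ** P ** Y) (E ** Y + VYi_at x ** (Y ** P ** Y))"
  have dZ_v: "dZ v = Y ** P ** Y"
    unfolding v_def by (rule dZ_coords) (simp add: matrix_transpose_mul Y P matrix_mul_assoc)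
  have adapted_dW_v: "adapted_dW x v = E ** Y"
    by (simp add: adapted_dW_def dZ_v) (simp add: v_def dW_coords)
  have 1: "trace (X ** P ** X ** map_matrix cnj (dZ v)) = trace (transpose P ** map_matrix cnj P)"
  proof -
    have "trace (X ** P ** X ** map_matrix cnj (dZ v)) = trace (X ** P ** (X ** Y) ** map_matrix cnj P ** Y)"
      by (simp add: dZ_v map_cnj_mult cnj_Y matrix_mul_assoc)
    also have "\<dots> = trace (Y ** (X ** P ** map_matrix cnj P))"
      using trace_mul_sym[of "X ** P ** map_matrix cnj P" Y] by (simp add: XY)
    also have "\<dots> = trace (P ** map_matrix cnj P)"
      by (simp add: matrix_mul_assoc YX)
    finally show ?thesis
      by (simp add: P)
  qed
  have 2: "trace (X ** transpose E ** map_matrix cnj (adapted_dW x v)) = trace (transpose E ** map_matrix cnj E)"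
    using trace_mul_sym[of "X ** transpose E ** map_matrix cnj E" Y]
    by (simp add: adapted_dW_v map_cnj_mult cnj_Y matrix_mul_assoc YX)
  let ?p = "\<Sum>j\<in>UNIV. \<Sum>i\<in>UNIV. (cmod (P $ i $ j))\<^sup>2"
  let ?e = "\<Sum>j\<in>UNIV. \<Sum>i\<in>UNIV. (cmod (E $ i $ j))\<^sup>2"
  have "complex_of_real (A * ?p + B * ?e) = 0"
    using zero[of v] 1 2
    by (simp add: ds2_completed_square[OF inv] trace_transpose_cnj flip: X_def P_def E_def)
  then have "A * ?p + B * ?e = 0"
    by (simp only: of_real_eq_0_iff)
  moreover have "?p \<ge> 0" "?e \<ge> 0"
    by (simp_all add: sum_nonneg)
  ultimately have "?p = 0" "?e = 0"
    using assms(1,2) by (auto simp: add_nonneg_eq_0_iff)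
  then have "P = 0" "E = 0"
    by (simp_all add: sum_nonneg_eq_0_iff sum_nonneg vec_eq_iff)
  then have "Z_of u = 0" "W_of u = 0"
    by (simp_all add: P_def E_def adapted_dW_def dZ_eq_Z_of dW_eq_W_of)
  then have "u = coords 0 0"
    using coords_Z_of_W_of[of u] by simp
  then show ?thesis
    by (simp add: coords_def vec_eq_iff split: sum.split)
qed

text \<open>
  The vector \<open>G\<close> of Christoffel coefficients with lower indices \<open>\<gamma>\<close>, \<open>\<beta>\<close> is determined by its pairing
  with all basis vectors.
\<close>

lemma christoffel_eqI:
  fixes h :: "complex ^ 'k::finite \<Rightarrow> complex ^ 'k ^ 'k"
  assumes nondeg: "\<And>g. (\<And>\<delta>. (\<Sum>\<alpha>\<in>UNIV. h x $ \<alpha> $ \<delta> * g $ \<alpha>) = 0) \<Longrightarrow> g = 0"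
    and G: "\<And>\<delta>. (\<Sum>\<alpha>\<in>UNIV. h x $ \<alpha> $ \<delta> * G $ \<alpha>) = wirtinger (\<lambda>y. h y $ \<beta> $ \<delta>) \<gamma> x"
  shows "christoffel h x \<alpha> \<gamma> \<beta> = G $ \<alpha>"
proof -
  let ?H = "transpose (h x)"
  have mult: "?H *v g = (\<chi> \<delta>. \<Sum>\<alpha>\<in>UNIV. h x $ \<alpha> $ \<delta> * g $ \<alpha>)" for g
    unfolding matrix_vector_mult_def transpose_def by simp
  have "\<forall>g. ?H *v g = 0 \<longrightarrow> g = 0"
  proof (intro allI impI)
    fix g assume "?H *v g = 0"
    then show "g = 0"
      unfolding mult by (intro nondeg) (simp add: vec_eq_iff)
  qed
  then have inv: "invertible ?H"
    unfolding invertible_left_inverse matrix_left_invertible_ker .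
  have "christoffel h x \<alpha> \<gamma> \<beta> = (matrix_inv ?H *v (?H *v G)) $ \<alpha>"
    unfolding mult by (simp add: christoffel_def inverse_metric_def matrix_vector_mult_def G)
  then show ?thesis
    by (simp only: matrix_vector_mul_assoc matrix_inv_mult[OF inv] matrix_vector_mul_lid)
qed

lemma bilinear_eq_sum:
  fixes g :: "complex ^ 'k::finite \<Rightarrow> complex ^ 'l::finite \<Rightarrow> complex"
  assumes "\<And>u u' v. g (u + u') v = g u v + g u' v" "\<And>c u v. g (c *s u) v = c * g u v"
    and "\<And>u v v'. g u (v + v') = g u v + g u v'" "\<And>c u v. g u (c *s v) = c * g u v"
  shows "g u v = (\<Sum>\<beta>\<in>UNIV. \<Sum>\<gamma>\<in>UNIV. g (axis \<beta> 1) (axis \<gamma> 1) * (u $ \<beta> * v $ \<gamma>))"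
proof -
  have zero: "g 0 v = 0" "g u 0 = 0" for u v
    using assms(2)[of 0 0 v] assms(4)[of u 0 0] by simp_all
  have left: "g (\<Sum>\<beta>\<in>S. a \<beta> *s e \<beta>) w = (\<Sum>\<beta>\<in>S. a \<beta> * g (e \<beta>) w)"
    if "finite S" for S :: "'k set" and a e w
    using that by (induction S rule: finite_induct) (simp_all add: zero assms)
  have right: "g w (\<Sum>\<beta>\<in>S. a \<beta> *s e \<beta>) = (\<Sum>\<beta>\<in>S. a \<beta> * g w (e \<beta>))"
    if "finite S" for S :: "'l set" and a e w
    using that by (induction S rule: finite_induct) (simp_all add: zero assms)
  have "g u v = g (\<Sum>\<beta>\<in>UNIV. u $ \<beta> *s axis \<beta> 1) (\<Sum>\<gamma>\<in>UNIV. v $ \<gamma> *s axis \<gamma> 1)"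
    by (simp add: basis_expansion)
  also have "\<dots> = (\<Sum>\<beta>\<in>UNIV. u $ \<beta> * (\<Sum>\<gamma>\<in>UNIV. v $ \<gamma> * g (axis \<beta> 1) (axis \<gamma> 1)))"
    by (subst left, simp, subst right, simp, rule refl)
  finally show ?thesis
    by (simp add: sum_distrib_left mult_ac)
qed

text \<open>
  If the Christoffel coefficients come from a symmetric bilinear form, the symmetric products of
  differentials add up to that form, and the connection is its negative.
\<close>

lemma chern_diff_eqI:
  fixes h :: "complex ^ 'k::finite \<Rightarrow> complex ^ 'k ^ 'k"
  assumes "\<And>u u' v. g (u + u') v = g u v + g u' v" "\<And>c u v. g (c *s u) v = c * g u v"
    and sym: "\<And>u v. g u v = g v u"
    and christoffel: "\<And>\<beta> \<gamma>. christoffel h x \<alpha> \<beta> \<gamma> = g (axis \<beta> 1) (axis \<gamma> 1)"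
  shows "chern_diff h x \<alpha> u v = - g u v"
proof -
  have right: "g u (v + v') = g u v + g u v'" "g u (c *s v) = c * g u v" for u v v' c
    using assms(1,2) sym by metis+
  note expand = bilinear_eq_sum[of g, OF assms(1,2) right]
  have "chern_diff h x \<alpha> u v = - ((\<Sum>\<beta>\<in>UNIV. \<Sum>\<gamma>\<in>UNIV. g (axis \<beta> 1) (axis \<gamma> 1) * (u $ \<beta> * v $ \<gamma>))
      + (\<Sum>\<beta>\<in>UNIV. \<Sum>\<gamma>\<in>UNIV. g (axis \<beta> 1) (axis \<gamma> 1) * (v $ \<beta> * u $ \<gamma>))) / 2"
    by (simp add: chern_diff_def christoffel sym_prod_def coord_diff_def add_divide_distrib
        distrib_left sum.distrib flip: sum_divide_distrib)
  also have "\<dots> = - (g u v + g v u) / 2"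
    by (simp only: expand[symmetric])
  finally show ?thesis
    by (simp add: sym[of v u])
qed

section \<open>The Christoffel coefficients of the Siegel--Jacobi metric\<close>

lemma mscale_add: "c *\<^sub>m (M + N) = c *\<^sub>m M + c *\<^sub>m N" for c :: complex
  by (simp add: mscale_def vec_eq_iff distrib_left)

lemma mscale_mscale: "c *\<^sub>m (d *\<^sub>m M) = (c * d) *\<^sub>m M" for c :: complex
  by (simp add: mscale_def vec_eq_iff)

text \<open>
  The image of the vector \<open>\<Gamma>(u, w)\<close>, with components \<open>\<Sum>\<beta> \<gamma>. \<Gamma>\<^sup>\<alpha>\<^sub>\<beta>\<^sub>\<gamma> u\<^sub>\<beta> w\<^sub>\<gamma>\<close>, under \<open>adapted_dW\<close>.
\<close>

definition gamma_adapted ::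
    "('n::{finite, linorder}, 'm::finite) coord_vec \<Rightarrow> ('n, 'm) coord_vec \<Rightarrow> ('n, 'm) coord_vec \<Rightarrow>
     ('m, 'n) cmat" where
  "gamma_adapted x u w =
     (\<i> / 2) *\<^sub>m (adapted_dW x u ** Yi_at x ** dZ w + adapted_dW x w ** Yi_at x ** dZ u)"

text \<open>The image of \<open>\<Gamma>(u, w)\<close> under \<open>dZ\<close>.\<close>

definition gamma_Z ::
    "real \<Rightarrow> real \<Rightarrow> ('n::{finite, linorder}, 'm::finite) coord_vec \<Rightarrow>
     ('n, 'm) coord_vec \<Rightarrow> ('n, 'm) coord_vec \<Rightarrow> ('n, 'n) cmat" where
  "gamma_Z A B x u w =
     (\<i> / 2) *\<^sub>m (dZ u ** Yi_at x ** dZ w + dZ w ** Yi_at x ** dZ u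
       + (of_real B / (2 * of_real A)) *\<^sub>m
           (transpose (adapted_dW x u) ** adapted_dW x w + transpose (adapted_dW x w) ** adapted_dW x u))"

text \<open>
  The vector \<open>\<Gamma>(u, w)\<close> itself, assembled from these two images. That its components are given by the
  Christoffel coefficients of the metric is the content of lemma \<open>christoffel_sj_metric\<close>.
\<close>

definition gamma_vec ::
    "real \<Rightarrow> real \<Rightarrow> ('n::{finite, linorder}, 'm::finite) coord_vec \<Rightarrow>
     ('n, 'm) coord_vec \<Rightarrow> ('n, 'm) coord_vec \<Rightarrow> ('n, 'm) coord_vec" where
  "gamma_vec A B x u w = coords (gamma_Z A B x u w) (VYi_at x ** gamma_Z A B x u w + gamma_adapted x u w)"

lemma transpose_gamma_Z:
  assumes "invertible (Im_matrix (Z_of x))"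
  shows "transpose (gamma_Z A B x u w) = gamma_Z A B x u w"
  by (simp add: gamma_Z_def mscale_simps matrix_add_simps matrix_transpose_mul transpose_dZ
      transpose_Yi_at[OF assms] matrix_mul_assoc add_ac)

lemma dZ_gamma_vec:
  assumes "invertible (Im_matrix (Z_of x))"
  shows "dZ (gamma_vec A B x u w) = gamma_Z A B x u w"
  unfolding gamma_vec_def by (rule dZ_coords[OF transpose_gamma_Z[OF assms]])

lemma dW_gamma_vec: "dW (gamma_vec A B x u w) = VYi_at x ** gamma_Z A B x u w + gamma_adapted x u w"
  by (simp add: gamma_vec_def dW_coords)

lemma gamma_sym: "gamma_Z A B x u w = gamma_Z A B x w u" "gamma_adapted x u w = gamma_adapted x w u"
  by (simp_all add: gamma_Z_def gamma_adapted_def add_ac)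

lemma adapted_dW_linear:
  "adapted_dW x (u + u') = adapted_dW x u + adapted_dW x u'"
  "adapted_dW x (c *s u) = c *\<^sub>m adapted_dW x u"
  by (simp_all add: adapted_dW_def dZ_dW_linear matrix_add_simps mscale_simps)
     (simp add: mscale_def vec_eq_iff algebra_simps)

lemma gamma_linear:
  "gamma_Z A B x (u + u') w = gamma_Z A B x u w + gamma_Z A B x u' w"
  "gamma_Z A B x (c *s u) w = c *\<^sub>m gamma_Z A B x u w"
  "gamma_adapted x (u + u') w = gamma_adapted x u w + gamma_adapted x u' w"
  "gamma_adapted x (c *s u) w = c *\<^sub>m gamma_adapted x u w"
  by (simp_all add: gamma_Z_def gamma_adapted_def adapted_dW_linear dZ_dW_linear matrix_add_simps mscale_simps
      mscale_add mscale_mscale mult_ac add_ac)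

lemma coords_linear:
  "coords (M + M') (N + N') = coords M N + coords M' N'"
  "coords (c *\<^sub>m M) (c *\<^sub>m N) = c *s coords M N"
  by (simp_all add: coords_def mscale_def vec_eq_iff split: sum.split)

lemma gamma_vec_linear:
  "gamma_vec A B x (u + u') w = gamma_vec A B x u w + gamma_vec A B x u' w"
  "gamma_vec A B x (c *s u) w = c *s gamma_vec A B x u w"
  by (simp_all add: gamma_vec_def gamma_linear matrix_add_simps mscale_simps add_ac
      flip: coords_linear mscale_add)

text \<open>The defining equation \<open>ds\<^sup>2(\<Gamma>(u, w), v) = \<partial>\<^sub>u ds\<^sup>2(w, v)\<close> of the Christoffel coefficients.\<close>

lemma ds2_gamma_vec:
  assumes inv: "invertible (Im_matrix (Z_of x))" and "A \<noteq> 0"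
  shows "ds2 A B (Z_of x) (W_of x) (gamma_vec A B x u w) v
    = - (\<i> / 2) * metric_deriv A B x (dZ u) (dW u) w v"
proof -
  define X where "X = Yi_at x"
  define R where "R = map_matrix cnj (dZ v)"
  define F where "F = map_matrix cnj (adapted_dW x v)"
  define E where "E = adapted_dW x u"
  define E' where "E' = adapted_dW x w"
  define P where "P = dZ u"
  define P' where "P' = dZ w"
  have X: "transpose X = X"
    unfolding X_def by (rule transpose_Yi_at[OF inv])
  have P: "transpose P = P" "transpose P' = P'" and R: "transpose R = R"
    by (simp_all add: P_def P'_def R_def transpose_dZ flip: map_cnj_transpose)
  \<comment> \<open>The two summands of the \<open>B\<close>-part of \<open>gamma_Z\<close> contribute equally, as \<open>X\<close> and \<open>R\<close> are symmetric.\<close>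
  have swap: "trace (X ** transpose E' ** E ** X ** R) = trace (X ** transpose E ** E' ** X ** R)"
    using trace_transpose[of "X ** transpose E' ** E ** X ** R"]
      trace_mul_sym[of R "X ** transpose E ** E' ** X"]
    by (simp add: matrix_transpose_mul matrix_mul_assoc X R)
  have adapted_gamma: "adapted_dW x (gamma_vec A B x u w) = gamma_adapted x u w"
    by (simp add: adapted_dW_def dZ_gamma_vec[OF inv] dW_gamma_vec)
  have "ds2 A B (Z_of x) (W_of x) (gamma_vec A B x u w) v
      = of_real A * trace (X ** gamma_Z A B x u w ** X ** R)
        + of_real B * trace (X ** transpose (gamma_adapted x u w) ** F)"
    by (simp add: ds2_completed_square[OF inv] adapted_gamma dZ_gamma_vec[OF inv] X_def R_def F_def)
  also have "of_real A * trace (X ** gamma_Z A B x u w ** X ** R) =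
      \<i> / 2 * (of_real A * trace (X ** P ** X ** P' ** X ** R) + of_real A * trace (X ** P' ** X ** P ** X ** R)
          + of_real B * trace (X ** transpose E' ** E ** X ** R))"
    using \<open>A \<noteq> 0\<close>
    by (simp add: gamma_Z_def mscale_simps matrix_add_simps trace_add matrix_mul_assoc swap field_simps
        flip: X_def E_def E'_def P_def P'_def)
  also have "of_real B * trace (X ** transpose (gamma_adapted x u w) ** F) =
      \<i> / 2 * (of_real B * trace (X ** P ** X ** transpose E' ** F)
             + of_real B * trace (X ** transpose (E ** X ** P') ** F))"
    by (simp add: gamma_adapted_def mscale_simps matrix_add_simps trace_add matrix_mul_assoc
        matrix_transpose_mul P X algebra_simps flip: X_def E_def E'_def P_def P'_def)
  finally show ?thesis
    by (simp only: metric_deriv_def Let_def adapted_dW_def[symmetric] flip: X_def R_def F_def E_def E'_def P'_def)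
      (simp add: algebra_simps flip: P_def)
qed

lemma christoffel_sj_metric:
  assumes "A > 0" "B > 0" and inv: "invertible (Im_matrix (Z_of x))"
  shows "christoffel (sj_metric A B) x \<alpha> \<gamma> \<beta> = gamma_vec A B x (axis \<gamma> 1) (axis \<beta> 1) $ \<alpha>"
proof (rule christoffel_eqI)
  have sum: "(\<Sum>\<alpha>\<in>UNIV. sj_metric A B x $ \<alpha> $ \<delta> * g $ \<alpha>) = ds2 A B (Z_of x) (W_of x) g (axis \<delta> 1)"
    for g \<delta>
  proof -
    have "(\<Sum>\<beta>\<in>UNIV. sj_metric A B x $ \<alpha> $ \<beta> * coord_diff \<alpha> g * cnj (coord_diff \<beta> (axis \<delta> 1)))
        = sj_metric A B x $ \<alpha> $ \<delta> * g $ \<alpha>" for \<alpha>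
      by (simp add: coord_diff_def axis_def if_distrib cong: if_cong)
    then show ?thesis
      by (simp only: ds2_eq_sum)
  qed
  show "g = 0" if zero: "\<And>\<delta>. (\<Sum>\<alpha>\<in>UNIV. sj_metric A B x $ \<alpha> $ \<delta> * g $ \<alpha>) = 0" for g
  proof (rule ds2_nondegenerate[OF assms])
    fix v
    have "ds2 A B (Z_of x) (W_of x) g v =
        (\<Sum>\<delta>\<in>UNIV. (\<Sum>\<alpha>\<in>UNIV. sj_metric A B x $ \<alpha> $ \<delta> * g $ \<alpha>) * cnj (v $ \<delta>))"
      unfolding ds2_eq_sum coord_diff_def by (subst sum.swap) (simp add: sum_distrib_right)
    then show "ds2 A B (Z_of x) (W_of x) g v = 0"
      by (simp add: zero)
  qed
  show "(\<Sum>\<alpha>\<in>UNIV. sj_metric A B x $ \<alpha> $ \<delta> * gamma_vec A B x (axis \<gamma> 1) (axis \<beta> 1) $ \<alpha>)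
      = wirtinger (\<lambda>y. sj_metric A B y $ \<beta> $ \<delta>) \<gamma> x" for \<delta>
    using assms(1) by (simp add: sum ds2_gamma_vec[OF inv] wirtinger_sj_metric[OF inv])
qed

lemma chern_diff_sj_metric:
  assumes "A > 0" "B > 0" and inv: "invertible (Im_matrix (Z_of x))"
  shows "chern_diff (sj_metric A B) x \<alpha> u v = - (gamma_vec A B x u v $ \<alpha>)"
  by (rule chern_diff_eqI)
    (simp_all add: gamma_vec_linear christoffel_sj_metric[OF assms], simp add: gamma_vec_def gamma_sym)

section \<open>The connection in block matrix form\<close>

lemma pos_def_imp_invertible:
  assumes "pos_def Y"
  shows "invertible Y"
  unfolding invertible_left_inverse matrix_left_invertible_ker
  using assms unfolding pos_def_def by (metis inner_zero_right less_irrefl)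

lemma hblock_mult_vblock:
  fixes M :: "complex ^ 'p::finite ^ 'r::finite" and N :: "complex ^ 'q::finite ^ 'r"
  shows "hblock M N ** vblock K L = M ** K + N ** L"
proof -
  have "(\<Sum>k\<in>UNIV. f k) = (\<Sum>a\<in>UNIV. f (Inl a)) + (\<Sum>b\<in>UNIV. f (Inr b))"
    for f :: "'p + 'q \<Rightarrow> complex"
    using sum.Plus[of UNIV UNIV f] by (simp add: UNIV_Plus_UNIV)
  then show ?thesis
    by (simp add: hblock_def vblock_def matrix_matrix_mult_def vec_eq_iff)
qed

lemma mult_hblock: "L ** hblock M N = hblock (L ** M) (L ** N)"
  by (auto simp add: hblock_def matrix_matrix_mult_def vec_eq_iff split: sum.split)

lemma hblock_add: "hblock M N + hblock M' N' = hblock (M + M') (N + N')"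
  by (auto simp add: hblock_def vec_eq_iff split: sum.split)

lemma form_matrix_mult_eq: "(\<Phi> \<odot> \<Psi>) u v = (1 / 2) *\<^sub>m (\<Phi> u ** \<Psi> v + \<Phi> v ** \<Psi> u)"
  by (simp add: form_matrix_mult_def sym_prod_def mscale_def matrix_matrix_mult_def vec_eq_iff
      add_divide_distrib sum.distrib flip: sum_divide_distrib)

theorem theorem1p3:
  fixes A B :: real
    and Z :: "('n::{finite, linorder}, 'n) cmat"
    and W :: "('m::finite, 'n) cmat"
    and Yi :: "('n, 'n) cmat" and V :: "('m, 'n) cmat"
  assumes "A > 0" and "B > 0"
    and "(Z, W) \<in> siegel_jacobi"
  defines "Yi \<equiv> complex_matrix (matrix_inv (Im_matrix Z))"
    and "V \<equiv> complex_matrix (Im_matrix W)"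
  shows
    "D_dZ A B Z W = (\<lambda>u v.
       - (\<i> * of_real B / (2 * of_real A)) *\<^sub>m
         ((\<lambda>u. hblock (dZ u) (transpose (dW u)) **
               vblock (hblock ((2 * (of_real A / of_real B)) *\<^sub>m Yi + Yi ** transpose V ** V ** Yi)
                              (- (Yi ** transpose V)))
                      (hblock (- (V ** Yi)) (mat 1)))
          \<odot> (\<lambda>u. vblock (dZ u) (dW u))) u v)
     \<and>
     D_dW A B Z W = (\<lambda>u v.
       - (\<i> * of_real B / (2 * of_real A)) *\<^sub>m
         (V ** Yi **
          ((\<lambda>u. hblock (dZ u) (transpose (dW u)) **
                vblock (hblock (Yi ** transpose V ** V ** Yi) (- (Yi ** transpose V)))
                       (hblock (- (V ** Yi)) (mat 1)))
           \<odot> (\<lambda>u. vblock (dZ u) (dW u))) u v)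
       - \<i> *\<^sub>m ((\<lambda>u. dW u ** Yi) \<odot> dZ) u v)"
proof -
  define x where "x = coords Z W"
  have Z: "transpose Z = Z" "pos_def (Im_matrix Z)"
    using assms(3) by (simp_all add: siegel_jacobi_def siegel_def)
  have Z_x: "Z_of x = Z" and W_x: "W_of x = W"
    by (simp_all add: x_def Z_of_coords Z W_of_coords)
  have inv: "invertible (Im_matrix (Z_of x))"
    using Z by (simp add: Z_x pos_def_imp_invertible)
  have Yi: "Yi_at x = Yi"
    by (simp add: Yi_at_def Yi_def Z_x)
  have VYi: "VYi_at x = V ** Yi"
    by (simp add: VYi_at_def Yi V_def W_x)
  have trans_Yi: "transpose Yi = Yi"
    using transpose_Yi_at[OF inv] by (simp add: Yi)
  have adapted_dW: "adapted_dW x u = dW u - V ** Yi ** dZ u" for u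
    by (simp add: adapted_dW_def VYi)
  have D_dZ: "D_dZ A B Z W u v = - gamma_Z A B x u v" for u v
    using chern_diff_sj_metric[OF assms(1,2) inv] dZ_gamma_vec[OF inv, of A B u v]
    by (simp add: D_dZ_def x_def[symmetric] dZ_def coord_diff_def vec_eq_iff)
  have D_dW: "D_dW A B Z W u v = - (VYi_at x ** gamma_Z A B x u v + gamma_adapted x u v)" for u v
    using chern_diff_sj_metric[OF assms(1,2) inv] dW_gamma_vec[of A B x u v]
    by (simp add: D_dW_def x_def[symmetric] dW_def coord_diff_def vec_eq_iff)
  note expand = form_matrix_mult_eq hblock_mult_vblock mult_hblock hblock_add
    adapted_dW Yi VYi transpose_diff matrix_transpose_mul trans_Yi transpose_dZ matrix_mult_diff
    matrix_mult_minus matrix_add_simps mscale_simps matrix_mul_assoc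
  have gamma_Z: "- gamma_Z A B x u v = - (\<i> * of_real B / (2 * of_real A)) *\<^sub>m
         ((\<lambda>u. hblock (dZ u) (transpose (dW u)) **
               vblock (hblock ((2 * (of_real A / of_real B)) *\<^sub>m Yi + Yi ** transpose V ** V ** Yi)
                              (- (Yi ** transpose V)))
                      (hblock (- (V ** Yi)) (mat 1)))
          \<odot> (\<lambda>u. vblock (dZ u) (dW u))) u v" for u v
    using assms(1,2) unfolding gamma_Z_def
    by (simp add: expand) (simp add: mscale_def vec_eq_iff field_simps)
  have gamma_W: "- (VYi_at x ** gamma_Z A B x u v + gamma_adapted x u v) =
       - (\<i> * of_real B / (2 * of_real A)) *\<^sub>m
         (V ** Yi **
          ((\<lambda>u. hblock (dZ u) (transpose (dW u)) **
                vblock (hblock (Yi ** transpose V ** V ** Yi) (- (Yi ** transpose V)))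
                       (hblock (- (V ** Yi)) (mat 1)))
           \<odot> (\<lambda>u. vblock (dZ u) (dW u))) u v)
       - \<i> *\<^sub>m ((\<lambda>u. dW u ** Yi) \<odot> dZ) u v" for u v
    using assms(1,2) unfolding gamma_Z_def gamma_adapted_def
    by (simp add: expand) (simp add: mscale_def vec_eq_iff field_simps)
  show ?thesis
    by (intro conjI ext) (simp_all only: D_dZ D_dW gamma_Z gamma_W)
qed

end
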